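(* Let $\Sigma$ be the signature for the syntax of first-order arithmetic given in the context. There is a compositional bijection $e\mapsto\hat e$ (first-order expressions being taken up to $\equiv$ and framework terms up to $\approx_\alpha$) between: (i) terms $t$ of first-order arithmetic and ground terms $\hat t$ of the nominal framework such that $\cdot;\widehat{fv(t)}\vdash_\Sigma\hat t:\mathsf{Term}$; (ii) formulae $\varphi$ of first-order arithmetic and ground terms $\hat\varphi$ of the nominal framework such that $\cdot;\widehat{fv(\varphi)}\vdash_\Sigma\hat\varphi:\mathsf{Form}$. That is, the map sends each $t$ (resp. $\varphi$) to a framework term satisfying the displayed judgement; it is injective modulo the two identities; every framework ground term of sort $\mathsf{Term}$ (resp. $\mathsf{Form}$) in a context $\hat{\mathcal{X}}$, for some finite set of variables $\mathcal{X}$, is in its image modulo $\approx_\alpha$; and for every expression $e$, variable $x_i$ and term $t$, $\widehat{e[x_i:=t]}\approx_\alpha\hat e[a_i\mapsto\hat t]$.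
   Context: **First-order arithmetic.** Variables $x_i$ are taken from a denumerable set. Terms: $t::=x\mid 0\mid S\,t\mid t_1+t_2\mid t_1\times t_2$. Formulae: $\varphi::=t_1=t_2\mid\bot\mid\neg\varphi\mid\varphi_1\supset\varphi_2\mid(\forall x)\varphi$. Expressions $e$ are terms or formulae; $fv$ is the usual set of free variables. $\equiv$ is identity on expressions: syntactic identity on terms, and on formulae the congruence generated by the rule: $(\forall x)\varphi\equiv(\forall y)\varphi'$ if $\varphi^x_z\equiv\varphi'^y_z$ for some $z\notin fv(\varphi)\cup fv(\varphi')$, where $\varphi^x_z$ is the swapping of the occurrences of $x$ and $z$ in $\varphi$. Substitution $e[y:=t]$ is the usual capture-avoiding one, well defined up to $\equiv$, with $((\forall x)\varphi)[y:=t]\equiv(\forall x)(\varphi[y:=t])$ when $x\notin fv(t)\cup\{y\}$. **Framework syntax.** Countably infinitely many atoms $a,b,c,\dots$. Sorts $\gamma::=\mathcal{F}\,\overline t\mid\ \ll a:\mathcal{F}\,\overline t\gg\gamma$, with $\mathcal{F}$ a sort constructor; ground terms $t::=a\mid f\,\overline t\mid\ \ll a:\mathcal{F}\,\overline t\gg t$, with $f$ a term constructor. An expression $M$ is a sort or a term. A permutation $\pi$ of atoms acts on expressions by renaming all atoms (including abstracted ones); $(a\ b)$ is a swapping. Freshness: $a\mathrel\# b$ for $a\ne b$; $a\mathrel\#\mathcal{F}\,\overline t$ and $a\mathrel\# f\,\overline t$ if $a\mathrel\# t_i$ for all $i$; $a\mathrel\#\ll a:\mathcal{F}\,\overline t\gg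 M$ if $a\mathrel\#\mathcal{F}\,\overline t$; $a\mathrel\#\ll b:\mathcal{F}\,\overline t\gg M$ ($b\ne a$) if $a\mathrel\#\mathcal{F}\,\overline t$ and $a\mathrel\# M$. $\approx_\alpha$: $a\approx_\alpha a$; componentwise for $\mathcal{F}\,\overline t$ and $f\,\overline t$; $\ll a:\mathcal{F}\,\overline t\gg M\approx_\alpha\ \ll a:\mathcal{F}\,\overline u\gg M'$ if $\mathcal{F}\,\overline t\approx_\alpha\mathcal{F}\,\overline u$ and $M\approx_\alpha M'$; $\ll a:\mathcal{F}\,\overline t\gg M\approx_\alpha\ \ll b:\mathcal{F}\,\overline u\gg M'$ ($a\ne b$) if $\mathcal{F}\,\overline t\approx_\alpha\mathcal{F}\,\overline u$, $M\approx_\alpha(a\ b)\cdot M'$ and $a\mathrel\# M'$. Atom substitution $M[a\mapsto t]$: $a\mapsto t$; $b\mapsto b$; componentwise on $f$, $\mathcal{F}$; $(\ll a:\mathcal{F}\,\overline s\gg M)[a\mapsto t]=\ \ll a:\mathcal{F}\,\overline{s[a\mapsto t]}\gg M$; $(\ll b:\mathcal{F}\,\overline s\gg M)[a\mapsto t]=\ \ll c:\mathcal{F}\,\overline{s[a\mapsto t]}\gg(((b\ c)\cdot M)[a\mapsto t])$ for $b\ne a$, with $c\neq a,b$ chosen with $c\mathrel\# M$, $c\mathrel\# t$. **Signature $\Sigma$** (all freshness contexts empty; "$\_$" is an unused name). Sort constructors without parameters: $\mathsf{Term}:\mathsf{data}$, $\mathsf{Form}:\mathsf{data}$. Term constructors: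 $0:\mathsf{Term}$; $S:(\_:\mathsf{Term})\to\mathsf{Term}$; $+,\times:(\_:\mathsf{Term},\_:\mathsf{Term})\to\mathsf{Term}$; $=\ :(\_:\mathsf{Term},\_:\mathsf{Term})\to\mathsf{Form}$; $\bot:\mathsf{Form}$; $\neg:(\_:\mathsf{Form})\to\mathsf{Form}$; $\supset\ :(\_:\mathsf{Form},\_:\mathsf{Form})\to\mathsf{Form}$; $\forall:(\_:\ \ll\_:\mathsf{Term}\gg\mathsf{Form})\to\mathsf{Form}$. **Sorting judgements.** A context $\Gamma$ is a sequence of declarations of distinct atoms with data sorts. The framework's judgement $\cdot;\Gamma\vdash_\Sigma t:\gamma$ ($\cdot$ the empty parameter telescope), restricted to ground terms over the signature $\Sigma$ (whose sort constructors are $\mathsf{Term},\mathsf{Form}$ and whose term constructors are $0,S,+,\times,=,\bot,\neg,\supset,\forall$), is generated by: $\cdot;\Gamma\vdash_\Sigma a:\Gamma(a)$ for $a\in\mathrm{dom}(\Gamma)$; if $f:(\_:\gamma_1,\dots,\_:\gamma_n)\to\mathcal{F}$ is in $\Sigma$ and $\cdot;\Gamma\vdash_\Sigma t_i:\gamma_i$ for all $i$ then $\cdot;\Gamma\vdash_\Sigma f(t_1,\dots,t_n):\mathcal{F}$; if $\cdot;\Gamma,b:\mathcal{F}\vdash_\Sigma(a\ b)\cdot t:(a\ b)\cdot\gamma$ with $b\notin\mathrm{dom}(\Gamma)$, $b\mathrel\# t$, $b\mathrel\#\gamma$, then $\cdot;\Gamma\vdash_\Sigma\ \ll a:\mathcal{F}\gg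 t:\ \ll a:\mathcal{F}\gg\gamma$; if $\cdot;\Gamma\vdash_\Sigma t:\gamma$ and $\gamma\approx_\alpha\gamma'$ then $\cdot;\Gamma\vdash_\Sigma t:\gamma'$. **Notation.** Each variable $x_i$ is encoded as a distinct atom $a_i$. For a finite set $\mathcal{X}$ of variables, $\hat{\mathcal{X}}$ is a context containing $a_i:\mathsf{Term}$ exactly for those $i$ with $x_i\in\mathcal{X}$. "Compositional" means that substitution commutes with the encoding. *)

theory Defs
  imports Main "HOL-Combinatorics.Transposition"
begin
datatype var = X nat

datatype tm =
    TVar var
  | TZero
  | TSucc tm
  | TPlus tm tm
  | TTimes tm tm

datatype fm =
    FEq tm tm
  | FBot
  | FNot fm
  | FImp fm fm
  | FAll var fm

datatype expr = ETm tm | EFm fm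

primrec fv_tm :: "tm \<Rightarrow> var set" where
  "fv_tm (TVar x) = {x}"
| "fv_tm TZero = {}"
| "fv_tm (TSucc t) = fv_tm t"
| "fv_tm (TPlus t1 t2) = fv_tm t1 \<union> fv_tm t2"
| "fv_tm (TTimes t1 t2) = fv_tm t1 \<union> fv_tm t2"

primrec fv_fm :: "fm \<Rightarrow> var set" where
  "fv_fm (FEq t1 t2) = fv_tm t1 \<union> fv_tm t2"
| "fv_fm FBot = {}"
| "fv_fm (FNot \<phi>) = fv_fm \<phi>"
| "fv_fm (FImp \<phi> \<psi>) = fv_fm \<phi> \<union> fv_fm \<psi>"
| "fv_fm (FAll x \<phi>) = fv_fm \<phi> - {x}"

lemma finite_fv_tm [simp]: "finite (fv_tm t)"
  by (induction t) auto

lemma finite_fv_fm [simp]: "finite (fv_fm \<phi>)"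
  by (induction \<phi>) auto

primrec swap_tm :: "var \<Rightarrow> var \<Rightarrow> tm \<Rightarrow> tm" where
  "swap_tm x z (TVar y) = TVar (transpose x z y)"
| "swap_tm x z TZero = TZero"
| "swap_tm x z (TSucc t) = TSucc (swap_tm x z t)"
| "swap_tm x z (TPlus t1 t2) = TPlus (swap_tm x z t1) (swap_tm x z t2)"
| "swap_tm x z (TTimes t1 t2) = TTimes (swap_tm x z t1) (swap_tm x z t2)"

text \<open>All occurrences are swapped, including bound and binding ones.\<close>

primrec swap_fm :: "var \<Rightarrow> var \<Rightarrow> fm \<Rightarrow> fm" where
  "swap_fm x z (FEq t1 t2) = FEq (swap_tm x z t1) (swap_tm x z t2)"
| "swap_fm x z FBot = FBot"
| "swap_fm x z (FNot \<phi>) = FNot (swap_fm x z \<phi>)"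
| "swap_fm x z (FImp \<phi> \<psi>) = FImp (swap_fm x z \<phi>) (swap_fm x z \<psi>)"
| "swap_fm x z (FAll y \<phi>) = FAll (transpose x z y) (swap_fm x z \<phi>)"

lemma size_swap_fm [simp]: "size (swap_fm x z \<phi>) = size \<phi>"
  by (induction \<phi>) auto

inductive equiv_fm :: "fm \<Rightarrow> fm \<Rightarrow> bool" where
  refl: "equiv_fm \<phi> \<phi>"
| sym: "equiv_fm \<phi> \<psi> \<Longrightarrow> equiv_fm \<psi> \<phi>"
| trans: "equiv_fm \<phi> \<psi> \<Longrightarrow> equiv_fm \<psi> \<chi> \<Longrightarrow> equiv_fm \<phi> \<chi>"
| cong_Not: "equiv_fm \<phi> \<phi>' \<Longrightarrow> equiv_fm (FNot \<phi>) (FNot \<phi>')"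
| cong_Imp: "equiv_fm \<phi> \<phi>' \<Longrightarrow> equiv_fm \<psi> \<psi>' \<Longrightarrow> equiv_fm (FImp \<phi> \<psi>) (FImp \<phi>' \<psi>')"
| cong_All: "equiv_fm \<phi> \<phi>' \<Longrightarrow> equiv_fm (FAll x \<phi>) (FAll x \<phi>')"
| rename: "equiv_fm (swap_fm x z \<phi>) (swap_fm y z \<phi>') \<Longrightarrow> z \<notin> fv_fm \<phi> \<union> fv_fm \<phi>'
    \<Longrightarrow> equiv_fm (FAll x \<phi>) (FAll y \<phi>')"

fun equiv_expr :: "expr \<Rightarrow> expr \<Rightarrow> bool" where
  "equiv_expr (ETm t) (ETm t') \<longleftrightarrow> t = t'"
| "equiv_expr (EFm \<phi>) (EFm \<phi>') \<longleftrightarrow> equiv_fm \<phi> \<phi>'"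
| "equiv_expr _ _ \<longleftrightarrow> False"

primrec subst_tm :: "tm \<Rightarrow> var \<Rightarrow> tm \<Rightarrow> tm" where
  "subst_tm (TVar x) y t = (if x = y then t else TVar x)"
| "subst_tm TZero y t = TZero"
| "subst_tm (TSucc t1) y t = TSucc (subst_tm t1 y t)"
| "subst_tm (TPlus t1 t2) y t = TPlus (subst_tm t1 y t) (subst_tm t2 y t)"
| "subst_tm (TTimes t1 t2) y t = TTimes (subst_tm t1 y t) (subst_tm t2 y t)"

text \<open>The bound variable is renamed only when it would capture; the fresh variable is an
  arbitrary choice, which matters only up to \<^const>\<open>equiv_fm\<close>.\<close>

function subst_fm :: "fm \<Rightarrow> var \<Rightarrow> tm \<Rightarrow> fm" where
  "subst_fm (FEq t1 t2) y t = FEq (subst_tm t1 y t) (subst_tm t2 y t)"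
| "subst_fm FBot y t = FBot"
| "subst_fm (FNot \<phi>) y t = FNot (subst_fm \<phi> y t)"
| "subst_fm (FImp \<phi> \<psi>) y t = FImp (subst_fm \<phi> y t) (subst_fm \<psi> y t)"
| "subst_fm (FAll x \<phi>) y t =
    (if x = y then FAll x \<phi>
     else if x \<notin> fv_tm t then FAll x (subst_fm \<phi> y t)
     else let z = (SOME z. z \<notin> fv_tm t \<union> fv_fm \<phi> \<union> {x, y})
          in FAll z (subst_fm (swap_fm x z \<phi>) y t))"
  by pat_completeness auto
termination
  by (relation "measure (\<lambda>(\<phi>, y, t). size \<phi>)") auto

primrec subst_expr :: "expr \<Rightarrow> var \<Rightarrow> tm \<Rightarrow> expr" where
  "subst_expr (ETm s) y t = ETm (subst_tm s y t)"
| "subst_expr (EFm \<phi>) y t = EFm (subst_fm \<phi> y t)"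

datatype atom = A nat

datatype scon = Term | Form

datatype fcon = Zero_c | Succ_c | Plus_c | Times_c | Eq_c | Bot_c | Not_c | Imp_c | All_c

text \<open>\<open>GAbs a F ts M\<close> and \<open>SAbs a F ts \<gamma>\<close> are the abstractions of \<open>a : F ts\<close> in \<open>M\<close> and \<open>\<gamma>\<close>.
  The raw syntax imposes no arities on constructors; these are imposed by the sorting rules.\<close>

datatype gterm =
    GAtom atom
  | GApp fcon "gterm list"
  | GAbs atom scon "gterm list" gterm

datatype gsort =
    SData scon "gterm list"
  | SAbs atom scon "gterm list" gsort

primrec perm_term :: "(atom \<Rightarrow> atom) \<Rightarrow> gterm \<Rightarrow> gterm" where
  "perm_term \<pi> (GAtom a) = GAtom (\<pi> a)"
| "perm_term \<pi> (GApp f ts) = GApp f (map (perm_term \<pi>) ts)"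
| "perm_term \<pi> (GAbs a F ts M) = GAbs (\<pi> a) F (map (perm_term \<pi>) ts) (perm_term \<pi> M)"

primrec perm_sort :: "(atom \<Rightarrow> atom) \<Rightarrow> gsort \<Rightarrow> gsort" where
  "perm_sort \<pi> (SData F ts) = SData F (map (perm_term \<pi>) ts)"
| "perm_sort \<pi> (SAbs a F ts \<gamma>) = SAbs (\<pi> a) F (map (perm_term \<pi>) ts) (perm_sort \<pi> \<gamma>)"

lemma size_perm_term [simp]: "size (perm_term \<pi> M) = size M"
  by (induction M) (auto simp: size_list_conv_sum_list comp_def cong: map_cong)

fun fresh_term :: "atom \<Rightarrow> gterm \<Rightarrow> bool" where
  "fresh_term a (GAtom b) \<longleftrightarrow> a \<noteq> b"
| "fresh_term a (GApp f ts) \<longleftrightarrow> (\<forall>t\<in>set ts. fresh_term a t)"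
| "fresh_term a (GAbs b F ts M) \<longleftrightarrow> (\<forall>t\<in>set ts. fresh_term a t) \<and> (a = b \<or> fresh_term a M)"

primrec fresh_sort :: "atom \<Rightarrow> gsort \<Rightarrow> bool" where
  "fresh_sort a (SData F ts) \<longleftrightarrow> (\<forall>t\<in>set ts. fresh_term a t)"
| "fresh_sort a (SAbs b F ts \<gamma>) \<longleftrightarrow> (\<forall>t\<in>set ts. fresh_term a t) \<and> (a = b \<or> fresh_sort a \<gamma>)"

inductive alpha_term :: "gterm \<Rightarrow> gterm \<Rightarrow> bool" (infix "\<approx>\<^sub>\<alpha>" 50) where
  atom: "GAtom a \<approx>\<^sub>\<alpha> GAtom a"
| app: "list_all2 (\<approx>\<^sub>\<alpha>) ts us \<Longrightarrow> GApp f ts \<approx>\<^sub>\<alpha> GApp f us"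
| abs_same: "list_all2 (\<approx>\<^sub>\<alpha>) ts us \<Longrightarrow> M \<approx>\<^sub>\<alpha> M' \<Longrightarrow> GAbs a F ts M \<approx>\<^sub>\<alpha> GAbs a F us M'"
| abs_diff: "a \<noteq> b \<Longrightarrow> list_all2 (\<approx>\<^sub>\<alpha>) ts us \<Longrightarrow> M \<approx>\<^sub>\<alpha> perm_term (transpose a b) M'
    \<Longrightarrow> fresh_term a M' \<Longrightarrow> GAbs a F ts M \<approx>\<^sub>\<alpha> GAbs b F us M'"

inductive alpha_sort :: "gsort \<Rightarrow> gsort \<Rightarrow> bool" where
  data: "list_all2 (\<approx>\<^sub>\<alpha>) ts us \<Longrightarrow> alpha_sort (SData F ts) (SData F us)"
| abs_same: "list_all2 (\<approx>\<^sub>\<alpha>) ts us \<Longrightarrow> alpha_sort \<gamma> \<gamma>'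
    \<Longrightarrow> alpha_sort (SAbs a F ts \<gamma>) (SAbs a F us \<gamma>')"
| abs_diff: "a \<noteq> b \<Longrightarrow> list_all2 (\<approx>\<^sub>\<alpha>) ts us \<Longrightarrow> alpha_sort \<gamma> (perm_sort (transpose a b) \<gamma>')
    \<Longrightarrow> fresh_sort a \<gamma>' \<Longrightarrow> alpha_sort (SAbs a F ts \<gamma>) (SAbs b F us \<gamma>')"

function asubst :: "gterm \<Rightarrow> atom \<Rightarrow> gterm \<Rightarrow> gterm" where
  "asubst (GAtom b) a t = (if b = a then t else GAtom b)"
| "asubst (GApp f ts) a t = GApp f (map (\<lambda>s. asubst s a t) ts)"
| "asubst (GAbs b F ts M) a t =
    (if b = a then GAbs a F (map (\<lambda>s. asubst s a t) ts) M
     else let c = (SOME c. c \<noteq> a \<and> c \<noteq> b \<and> fresh_term c M \<and> fresh_term c t)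
          in GAbs c F (map (\<lambda>s. asubst s a t) ts) (asubst (perm_term (transpose b c) M) a t))"
  by pat_completeness auto
termination
  by (relation "measure (\<lambda>(M, a, t). size M)")
    (auto simp: less_Suc_eq_le le_Suc_eq dest: size_list_estimation'[OF _ order_refl, of _ _ size])

text \<open>The name abstracted in the argument sort of \<^const>\<open>All_c\<close> is unused; which atom is
  taken is immaterial, since sorting is closed under \<^const>\<open>alpha_sort\<close>.\<close>

fun arith_sig :: "fcon \<Rightarrow> gsort list \<times> scon" where
  "arith_sig Zero_c = ([], Term)"
| "arith_sig Succ_c = ([SData Term []], Term)"
| "arith_sig Plus_c = ([SData Term [], SData Term []], Term)"
| "arith_sig Times_c = ([SData Term [], SData Term []], Term)"
| "arith_sig Eq_c = ([SData Term [], SData Term []], Form)"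
| "arith_sig Bot_c = ([], Form)"
| "arith_sig Not_c = ([SData Form []], Form)"
| "arith_sig Imp_c = ([SData Form [], SData Form []], Form)"
| "arith_sig All_c = ([SAbs (A 0) Term [] (SData Form [])], Form)"

text \<open>Both sort constructors are parameterless, so the data sorts over the signature are named
  by the constructors alone.\<close>

type_synonym ctx = "(atom \<times> scon) list"

definition dom_ctx :: "ctx \<Rightarrow> atom set" where
  "dom_ctx \<Gamma> = fst ` set \<Gamma>"

inductive has_sort :: "ctx \<Rightarrow> gterm \<Rightarrow> gsort \<Rightarrow> bool" where
  atom: "map_of \<Gamma> a = Some F \<Longrightarrow> has_sort \<Gamma> (GAtom a) (SData F [])"
| app: "arith_sig f = (\<gamma>s, F) \<Longrightarrow> list_all2 (has_sort \<Gamma>) ts \<gamma>s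
    \<Longrightarrow> has_sort \<Gamma> (GApp f ts) (SData F [])"
| abs: "has_sort (\<Gamma> @ [(b, F)]) (perm_term (transpose a b) t) (perm_sort (transpose a b) \<gamma>)
    \<Longrightarrow> b \<notin> dom_ctx \<Gamma> \<Longrightarrow> fresh_term b t \<Longrightarrow> fresh_sort b \<gamma>
    \<Longrightarrow> has_sort \<Gamma> (GAbs a F [] t) (SAbs a F [] \<gamma>)"
| conv: "has_sort \<Gamma> t \<gamma> \<Longrightarrow> alpha_sort \<gamma> \<gamma>' \<Longrightarrow> has_sort \<Gamma> t \<gamma>'"

text \<open>A relation, because a set of variables does not determine the order of the declarations.\<close>

definition hat_ctx :: "(var \<Rightarrow> atom) \<Rightarrow> var set \<Rightarrow> ctx \<Rightarrow> bool" where
  "hat_ctx a V \<Gamma> \<longleftrightarrow> distinct (map fst \<Gamma>) \<and> set \<Gamma> = (\<lambda>x. (a x, Term)) ` V"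

lemma hat_ctx_exists: "finite V \<Longrightarrow> \<exists>\<Gamma>. hat_ctx a V \<Gamma>"
proof -
  assume "finite V"
  then obtain as where "set as = a ` V" "distinct as"
    using finite_distinct_list by (metis finite_imageI)
  then have "hat_ctx a V (map (\<lambda>b. (b, Term)) as)"
    by (auto simp: hat_ctx_def comp_def)
  then show ?thesis ..
qed

end

theory Submission
  imports Defs
begin

text \<open>Framework terms are translated to locally nameless terms, where \<open>\<approx>\<^sub>\<alpha>\<close> becomes equality and
  substitution needs neither renaming nor shifting. The encoding maps \<open>\<forall>x\<close> to an abstraction of the
  atom of \<open>x\<close>; composed with the translation, its kernel is \<open>\<equiv>\<close> and it commutes with substitution,
  each by an induction in which the only interesting step is the exchange of a bound name for a
  fresh one. The sorting rule for abstractions may pick an atom that encodes no variable, so the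
  inductions on sorting are carried out for all renamings of the term at once.\<close>

section \<open>Locally nameless terms\<close>

text \<open>\<open>LBound\<close> is a de Bruijn index counting enclosing abstraction bodies;
  parameter lists lie outside the scope of their abstraction. The type of names is a parameter so
  that the datatype supplies \<open>map_ln\<close> and \<open>set_ln\<close>: renaming of the free
  names and the set of free names.\<close>

datatype 'a ln =
    LFree 'a
  | LBound nat
  | LApp fcon "'a ln list"
  | LAbs scon "'a ln list" "'a ln"

primrec close :: "nat \<Rightarrow> 'a \<Rightarrow> 'a ln \<Rightarrow> 'a ln" where
  "close k a (LFree b) = (if b = a then LBound k else LFree b)"
| "close k a (LBound i) = LBound i"
| "close k a (LApp f ts) = LApp f (map (close k a) ts)"
| "close k a (LAbs F ts M) = LAbs F (map (close k a) ts) (close (Suc k) a M)"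

primrec loc_closed :: "nat \<Rightarrow> 'a ln \<Rightarrow> bool" where
  "loc_closed k (LFree b) \<longleftrightarrow> True"
| "loc_closed k (LBound i) \<longleftrightarrow> i < k"
| "loc_closed k (LApp f ts) \<longleftrightarrow> list_all (loc_closed k) ts"
| "loc_closed k (LAbs F ts M) \<longleftrightarrow> list_all (loc_closed k) ts \<and> loc_closed (Suc k) M"

text \<open>\<open>T\<close> goes under abstractions without shifting, which is faithful when
  \<open>T\<close> has no dangling index, as holds for every value of
  \<open>nameless\<close>.\<close>

primrec lsubst :: "'a \<Rightarrow> 'a ln \<Rightarrow> 'a ln \<Rightarrow> 'a ln" where
  "lsubst a T (LFree b) = (if b = a then T else LFree b)"
| "lsubst a T (LBound i) = LBound i"
| "lsubst a T (LApp f ts) = LApp f (map (lsubst a T) ts)"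
| "lsubst a T (LAbs F ts M) = LAbs F (map (lsubst a T) ts) (lsubst a T M)"

lemma finite_set_ln [simp]: "finite (set_ln M)"
  by (induction M) auto

lemma set_ln_close [simp]: "set_ln (close k a M) = set_ln M - {a}"
  by (induction M arbitrary: k) auto

lemma loc_closed_close: "loc_closed k M \<Longrightarrow> loc_closed (Suc k) (close k a M)"
  by (induction M arbitrary: k) (auto simp: list_all_iff)

text \<open>Closing could only confuse \<open>a\<close> with an \<open>LBound k\<close> that was
  there before; local closedness at level \<open>k\<close> excludes such an index.\<close>

lemma close_inject:
  "close k a M = close k a N \<Longrightarrow> loc_closed k M \<Longrightarrow> loc_closed k N \<Longrightarrow> M = N"
proof (induction M arbitrary: k N)
  case (LFree b)
  then show ?case by (cases N) (auto split: if_splits)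
next
  case (LBound i)
  then show ?case by (cases N) (auto split: if_splits)
next
  case (LApp f ts)
  from LApp.prems(1) obtain us where N: "N = LApp f us" "map (close k a) ts = map (close k a) us"
    by (cases N) (auto split: if_splits)
  have "list_all2 (=) ts us"
    using LApp N by (auto simp: list_all2_conv_all_nth list_all_length list_eq_iff_nth_eq)
  then show ?case using N by (simp add: list.rel_eq)
next
  case (LAbs F ts M)
  from LAbs.prems(1) obtain us M' where N: "N = LAbs F us M'" "map (close k a) ts = map (close k a) us"
      "close (Suc k) a M = close (Suc k) a M'"
    by (cases N) (auto split: if_splits)
  have "list_all2 (=) ts us"
    using LAbs N by (auto simp: list_all2_conv_all_nth list_all_length list_eq_iff_nth_eq)
  then show ?case using N LAbs by (auto simp: list.rel_eq)
qed

lemma close_fresh: "a \<notin> set_ln M \<Longrightarrow> close k a M = M"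
  by (induction M arbitrary: k) (auto intro: map_idI)

lemma lsubst_fresh: "a \<notin> set_ln M \<Longrightarrow> lsubst a T M = M"
  by (induction M) (auto intro: map_idI)

lemma close_lsubst:
  "c \<noteq> a \<Longrightarrow> c \<notin> set_ln T \<Longrightarrow> close k c (lsubst a T M) = lsubst a T (close k c M)"
  by (induction M arbitrary: k) (auto simp: close_fresh)

lemma close_map_ln:
  "inj \<pi> \<Longrightarrow> close k (\<pi> a) (map_ln \<pi> M) = map_ln \<pi> (close k a M)"
  by (induction M arbitrary: k) (auto dest: injD)

text \<open>Closing is equivariant, and once \<open>a\<close> is closed neither \<open>a\<close> nor
  \<open>b\<close> is free, so the swap then does nothing.\<close>

lemma close_transpose:
  assumes "b \<notin> set_ln M"
  shows "close k b (map_ln (transpose a b) M) = close k a M"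
proof -
  have "close k b (map_ln (transpose a b) M) = map_ln (transpose a b) (close k a M)"
    using close_map_ln[of "transpose a b" k a M] by simp
  also have "\<dots> = map_ln id (close k a M)"
    using assms by (intro ln.map_cong refl) (auto simp: transpose_def)
  finally show ?thesis by (simp add: ln.map_id)
qed

section \<open>Framework terms modulo alpha-equivalence\<close>

primrec nameless :: "gterm \<Rightarrow> atom ln" where
  "nameless (GAtom a) = LFree a"
| "nameless (GApp f ts) = LApp f (map nameless ts)"
| "nameless (GAbs a F ts M) = LAbs F (map nameless ts) (close 0 a (nameless M))"

lemma loc_closed_nameless [simp]: "loc_closed 0 (nameless M)"
  by (induction M) (auto simp: list_all_iff loc_closed_close)

lemma perm_term_comp: "perm_term \<pi> (perm_term \<rho> M) = perm_term (\<pi> \<circ> \<rho>) M"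
  by (induction M) auto

lemma perm_term_id [simp]: "perm_term id M = M"
  by (induction M) (auto intro: map_idI)

text \<open>A permutation also renames abstracted atoms, but these leave no trace in the nameless
  term, so only the renaming of free atoms remains.\<close>

lemma nameless_perm: "inj \<pi> \<Longrightarrow> nameless (perm_term \<pi> M) = map_ln \<pi> (nameless M)"
  by (induction M) (auto simp: close_map_ln)

lemma fresh_term_iff: "fresh_term a M \<longleftrightarrow> a \<notin> set_ln (nameless M)"
  by (induction M) auto

text \<open>The one fact about renaming bound names that is used throughout: for alpha-equivalence,
  for capture avoidance and for the abstraction rule of sorting.\<close>

lemma close_nameless_transpose:
  "fresh_term b M \<Longrightarrow>
    close k b (nameless (perm_term (transpose a b) M)) = close k a (nameless M)"
  by (simp add: nameless_perm close_transpose fresh_term_iff)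

lemma alpha_imp_nameless_eq: "M \<approx>\<^sub>\<alpha> N \<Longrightarrow> nameless M = nameless N"
proof (induction rule: alpha_term.induct)
  case (abs_diff a b ts us M M' F)
  then show ?case
    using close_nameless_transpose[of a M' 0 b]
    by (auto simp: transpose_commute list_all2_conv_all_nth list_eq_iff_nth_eq)
qed (auto simp: list_all2_conv_all_nth list_eq_iff_nth_eq)

text \<open>Structural induction on \<open>M\<close> suffices because the alpha rule for different
  names swaps atoms only on the side of \<open>N\<close>, which is left arbitrary.\<close>

lemma nameless_eq_imp_alpha: "nameless M = nameless N \<Longrightarrow> M \<approx>\<^sub>\<alpha> N"
proof (induction M arbitrary: N)
  case (GAtom a)
  then show ?case by (cases N) (auto intro: alpha_term.intros)
next
  case (GApp f ts)
  from GApp.prems obtain us where N: "N = GApp f us" "map nameless ts = map nameless us"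
    by (cases N) auto
  have "list_all2 (\<approx>\<^sub>\<alpha>) ts us"
    using GApp.IH N(2) by (auto simp: list_all2_conv_all_nth list_eq_iff_nth_eq)
  then show ?case using N(1) by (simp add: alpha_term.app)
next
  case (GAbs a F ts M)
  from GAbs.prems obtain b us M' where N: "N = GAbs b F us M'" "map nameless ts = map nameless us"
      and eq: "close 0 a (nameless M) = close 0 b (nameless M')"
    by (cases N) auto
  have ts: "list_all2 (\<approx>\<^sub>\<alpha>) ts us"
    using GAbs.IH(1) N(2) by (auto simp: list_all2_conv_all_nth list_eq_iff_nth_eq)
  show ?case
  proof (cases "a = b")
    case True
    then have "M \<approx>\<^sub>\<alpha> M'"
      using eq close_inject[of 0 b "nameless M" "nameless M'"] GAbs.IH(2) by simp
    then show ?thesis using N ts True by (auto intro: alpha_term.intros)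
  next
    case False
    \<comment> \<open>The freshness premise of the alpha rule is read off the equation: its left
      side has closed \<open>a\<close>, so \<open>a\<close> is not free on the right either.\<close>
    have "a \<notin> set_ln (close 0 b (nameless M'))"
      unfolding eq[symmetric] by simp
    then have fresh: "fresh_term a M'" using False by (simp add: fresh_term_iff)
    then have "close 0 a (nameless M) = close 0 a (nameless (perm_term (transpose a b) M'))"
      using eq close_nameless_transpose[of a M' 0 b] by (simp add: transpose_commute)
    then have "M \<approx>\<^sub>\<alpha> perm_term (transpose a b) M'"
      by (intro GAbs.IH(2)) (auto intro: close_inject)
    then show ?thesis using N ts False fresh by (auto intro: alpha_term.intros)
  qed
qed

lemma alpha_iff_nameless_eq: "M \<approx>\<^sub>\<alpha> N \<longleftrightarrow> nameless M = nameless N"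
  using alpha_imp_nameless_eq nameless_eq_imp_alpha by blast

lemma infinite_atom: "infinite (UNIV :: atom set)"
proof -
  have "inj A" by (simp add: inj_def)
  then show ?thesis by (metis finite_imageD finite_subset infinite_UNIV_nat subset_UNIV)
qed

lemma infinite_var: "infinite (UNIV :: var set)"
proof -
  have "inj X" by (simp add: inj_def)
  then show ?thesis by (metis finite_imageD finite_subset infinite_UNIV_nat subset_UNIV)
qed

lemma nameless_asubst:
  "nameless (asubst M a t) = lsubst a (nameless t) (nameless M)"
proof (induction M a t rule: asubst.induct)
  case (3 b F ts M a t)
  show ?case
  proof (cases "b = a")
    case True
    \<comment> \<open>The closed body no longer contains \<open>a\<close>, so \<open>lsubst\<close>
      leaves it alone, just as \<open>asubst\<close> does.\<close>
    then show ?thesis using 3(1) by (simp add: lsubst_fresh)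
  next
    case False
    define c where "c = (SOME c. c \<noteq> a \<and> c \<noteq> b \<and> fresh_term c M \<and> fresh_term c t)"
    \<comment> \<open>Only finitely many atoms are excluded, so the choice made in
      \<open>asubst\<close> meets its specification.\<close>
    have "\<exists>c. c \<notin> {a, b} \<union> set_ln (nameless M) \<union> set_ln (nameless t)"
      using infinite_atom by (intro ex_new_if_finite) auto
    then have "\<exists>c. c \<noteq> a \<and> c \<noteq> b \<and> fresh_term c M \<and> fresh_term c t"
      by (auto simp: fresh_term_iff)
    then have "c \<noteq> a \<and> c \<noteq> b \<and> fresh_term c M \<and> fresh_term c t"
      unfolding c_def by (rule someI_ex)
    then have c: "c \<noteq> a" "fresh_term c M" "fresh_term c t" by auto
    have "close 0 c (nameless (asubst (perm_term (transpose b c) M) a t))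
        = lsubst a (nameless t) (close 0 c (nameless (perm_term (transpose b c) M)))"
      using 3(3)[OF False c_def] c by (simp add: close_lsubst fresh_term_iff)
    also have "\<dots> = lsubst a (nameless t) (close 0 b (nameless M))"
      using c by (simp add: close_nameless_transpose)
    finally show ?thesis
      using False 3(2)[OF False c_def] by (simp add: c_def[symmetric] Let_def)
  qed
qed auto

section \<open>The encoding\<close>

primrec enc_tm :: "(var \<Rightarrow> atom) \<Rightarrow> tm \<Rightarrow> gterm" where
  "enc_tm a (TVar x) = GAtom (a x)"
| "enc_tm a TZero = GApp Zero_c []"
| "enc_tm a (TSucc t) = GApp Succ_c [enc_tm a t]"
| "enc_tm a (TPlus t u) = GApp Plus_c [enc_tm a t, enc_tm a u]"
| "enc_tm a (TTimes t u) = GApp Times_c [enc_tm a t, enc_tm a u]"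

primrec enc_fm :: "(var \<Rightarrow> atom) \<Rightarrow> fm \<Rightarrow> gterm" where
  "enc_fm a (FEq t u) = GApp Eq_c [enc_tm a t, enc_tm a u]"
| "enc_fm a FBot = GApp Bot_c []"
| "enc_fm a (FNot \<phi>) = GApp Not_c [enc_fm a \<phi>]"
| "enc_fm a (FImp \<phi> \<psi>) = GApp Imp_c [enc_fm a \<phi>, enc_fm a \<psi>]"
| "enc_fm a (FAll x \<phi>) = GApp All_c [GAbs (a x) Term [] (enc_fm a \<phi>)]"

primrec enc_expr :: "(var \<Rightarrow> atom) \<Rightarrow> expr \<Rightarrow> gterm" where
  "enc_expr a (ETm t) = enc_tm a t"
| "enc_expr a (EFm \<phi>) = enc_fm a \<phi>"

lemma set_ln_enc_tm [simp]: "set_ln (nameless (enc_tm a t)) = a ` fv_tm t"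
  by (induction t) auto

lemma enc_tm_swap:
  "inj a \<Longrightarrow> enc_tm a (swap_tm x z t) = perm_term (transpose (a x) (a z)) (enc_tm a t)"
  by (induction t) (auto simp: transpose_def dest: injD)

text \<open>This is an equality of raw terms, since both operations rename binding occurrences as
  well.\<close>

lemma enc_fm_swap:
  "inj a \<Longrightarrow> enc_fm a (swap_fm x z \<phi>) = perm_term (transpose (a x) (a z)) (enc_fm a \<phi>)"
  by (induction \<phi>) (auto simp: enc_tm_swap transpose_def dest: injD)

lemma nameless_enc_tm_inject:
  "inj a \<Longrightarrow> nameless (enc_tm a t) = nameless (enc_tm a u) \<longleftrightarrow> t = u"
proof (induction t arbitrary: u)
  case (TVar x)
  then show ?case by (cases u) (auto dest: injD)
next
  case TZero
  then show ?case by (cases u) auto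
next
  case (TSucc t)
  then show ?case by (cases u) auto
next
  case (TPlus t1 t2)
  then show ?case by (cases u) auto
next
  case (TTimes t1 t2)
  then show ?case by (cases u) auto
qed

text \<open>Only sorts that occur in derivations for arguments of constructors of the signature matter;
  the other sorts get a trivial value. No constructor has a parameter, so parameter lists are
  ignored.\<close>

fun in_image :: "(var \<Rightarrow> atom) \<Rightarrow> gsort \<Rightarrow> atom ln \<Rightarrow> bool" where
  "in_image a (SData Term _) M \<longleftrightarrow> (\<exists>t. M = nameless (enc_tm a t))"
| "in_image a (SData Form _) M \<longleftrightarrow> (\<exists>\<phi>. M = nameless (enc_fm a \<phi>))"
| "in_image a (SAbs _ F _ \<gamma>) M \<longleftrightarrow> (F = Term \<and> (\<exists>ss. \<gamma> = SData Form ss) \<longrightarrow>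
    (\<exists>x \<phi>. M = nameless (GAbs (a x) Term [] (enc_fm a \<phi>))))"

text \<open>One existential goal for each term constructor of the signature; together they settle
  the application case of \<open>has_sort_in_image\<close>.\<close>

lemma ex_enc_eq:
  shows "\<exists>e. LApp Zero_c [] = nameless (enc_tm a e)"
    and "\<exists>e. LApp Bot_c [] = nameless (enc_fm a e)"
    and "\<exists>e. LApp Succ_c [nameless (enc_tm a t)] = nameless (enc_tm a e)"
    and "\<exists>e. LApp Plus_c [nameless (enc_tm a t), nameless (enc_tm a u)] = nameless (enc_tm a e)"
    and "\<exists>e. LApp Times_c [nameless (enc_tm a t), nameless (enc_tm a u)] = nameless (enc_tm a e)"
    and "\<exists>e. LApp Eq_c [nameless (enc_tm a t), nameless (enc_tm a u)] = nameless (enc_fm a e)"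
    and "\<exists>e. LApp Not_c [nameless (enc_fm a \<phi>)] = nameless (enc_fm a e)"
    and "\<exists>e. LApp Imp_c [nameless (enc_fm a \<phi>), nameless (enc_fm a \<psi>)] = nameless (enc_fm a e)"
    and "\<exists>e. LApp All_c [LAbs Term [] (close 0 (a x) (nameless (enc_fm a \<phi>)))] = nameless (enc_fm a e)"
proof -
  show "\<exists>e. LApp Zero_c [] = nameless (enc_tm a e)"
    by (rule exI[of _ TZero]) simp
  show "\<exists>e. LApp Bot_c [] = nameless (enc_fm a e)"
    by (rule exI[of _ FBot]) simp
  show "\<exists>e. LApp Succ_c [nameless (enc_tm a t)] = nameless (enc_tm a e)"
    by (rule exI[of _ "TSucc t"]) simp
  show "\<exists>e. LApp Plus_c [nameless (enc_tm a t), nameless (enc_tm a u)] = nameless (enc_tm a e)"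
    by (rule exI[of _ "TPlus t u"]) simp
  show "\<exists>e. LApp Times_c [nameless (enc_tm a t), nameless (enc_tm a u)] = nameless (enc_tm a e)"
    by (rule exI[of _ "TTimes t u"]) simp
  show "\<exists>e. LApp Eq_c [nameless (enc_tm a t), nameless (enc_tm a u)] = nameless (enc_fm a e)"
    by (rule exI[of _ "FEq t u"]) simp
  show "\<exists>e. LApp Not_c [nameless (enc_fm a \<phi>)] = nameless (enc_fm a e)"
    by (rule exI[of _ "FNot \<phi>"]) simp
  show "\<exists>e. LApp Imp_c [nameless (enc_fm a \<phi>), nameless (enc_fm a \<psi>)] = nameless (enc_fm a e)"
    by (rule exI[of _ "FImp \<phi> \<psi>"]) simp
  show "\<exists>e. LApp All_c [LAbs Term [] (close 0 (a x) (nameless (enc_fm a \<phi>)))] = nameless (enc_fm a e)"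
    by (rule exI[of _ "FAll x \<phi>"]) simp
qed

lemma perm_sort_eq_SData: "(\<exists>ss. perm_sort \<pi> \<gamma> = SData F ss) \<longleftrightarrow> (\<exists>ss. \<gamma> = SData F ss)"
  by (cases \<gamma>) auto

lemma alpha_sort_SData:
  "alpha_sort \<gamma> \<gamma>' \<Longrightarrow> (\<exists>ss. \<gamma> = SData F ss) \<longleftrightarrow> (\<exists>ss. \<gamma>' = SData F ss)"
  by (induction rule: alpha_sort.induct) auto

text \<open>\<open>in_image\<close> looks at sort constructors but never at abstracted atoms or
  parameters; this handles the conversion rule of sorting.\<close>

lemma in_image_alpha: "alpha_sort \<gamma> \<gamma>' \<Longrightarrow> in_image a \<gamma> = in_image a \<gamma>'"
proof (induction rule: alpha_sort.induct)
  case (data ts us F)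
  then show ?case by (cases F) auto
next
  case (abs_same ts us \<gamma> \<gamma>' c F)
  from abs_same.hyps(2) show ?case by (simp add: fun_eq_iff alpha_sort_SData)
next
  case (abs_diff c d ts us \<gamma> \<gamma>' F)
  from abs_diff.hyps(3) show ?case
    by (simp add: fun_eq_iff alpha_sort_SData perm_sort_eq_SData)
qed

section \<open>The kernel of the encoding\<close>

context
  fixes a :: "var \<Rightarrow> atom"
  assumes inj: "inj a"
begin

lemma set_ln_enc_fm [simp]: "set_ln (nameless (enc_fm a \<phi>)) = a ` fv_fm \<phi>"
  using inj by (induction \<phi>) (auto dest: injD)

lemma close_enc_fm_swap:
  "z \<notin> fv_fm \<phi> \<Longrightarrow>
    close k (a z) (nameless (enc_fm a (swap_fm x z \<phi>))) = close k (a x) (nameless (enc_fm a \<phi>))"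
  using inj
  by (subst enc_fm_swap)
    (auto simp: fresh_term_iff dest: injD intro!: close_nameless_transpose)

lemma equiv_fm_imp_nameless_eq:
  "equiv_fm \<phi> \<psi> \<Longrightarrow> nameless (enc_fm a \<phi>) = nameless (enc_fm a \<psi>)"
proof (induction rule: equiv_fm.induct)
  case (rename x z \<phi> y \<phi>')
  then show ?case
    using close_enc_fm_swap[of z \<phi> 0 x] close_enc_fm_swap[of z \<phi>' 0 y] by simp
qed auto

text \<open>The induction is on size because the hypothesis is applied to a swapped body, which need
  not be a subformula.\<close>

lemma nameless_eq_imp_equiv_fm:
  "nameless (enc_fm a \<phi>) = nameless (enc_fm a \<psi>) \<Longrightarrow> equiv_fm \<phi> \<psi>"
proof (induction "size \<phi>" arbitrary: \<phi> \<psi> rule: less_induct)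
  case less
  show ?case
  proof (cases \<phi>)
    case (FEq t u)
    then show ?thesis using less.prems
      by (cases \<psi>) (auto simp: nameless_enc_tm_inject[OF inj] intro: equiv_fm.refl)
  next
    case FBot
    then show ?thesis using less.prems by (cases \<psi>) (auto intro: equiv_fm.refl)
  next
    case (FNot \<phi>1)
    then show ?thesis using less by (cases \<psi>) (auto intro: equiv_fm.cong_Not)
  next
    case (FImp \<phi>1 \<phi>2)
    then show ?thesis using less by (cases \<psi>) (auto intro!: equiv_fm.cong_Imp)
  next
    case (FAll x \<phi>1)
    then obtain y \<psi>1 where psi: "\<psi> = FAll y \<psi>1"
      and eq: "close 0 (a x) (nameless (enc_fm a \<phi>1)) = close 0 (a y) (nameless (enc_fm a \<psi>1))"
      using less.prems by (cases \<psi>) auto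
    obtain z where z: "z \<notin> fv_fm \<phi>1 \<union> fv_fm \<psi>1"
      using ex_new_if_finite[OF infinite_var, of "fv_fm \<phi>1 \<union> fv_fm \<psi>1"] by auto
    \<comment> \<open>With a common fresh \<open>z\<close> both bodies are closed over the same
      atom, so \<open>close_inject\<close> can remove the binder.\<close>
    have "close 0 (a z) (nameless (enc_fm a (swap_fm x z \<phi>1)))
        = close 0 (a z) (nameless (enc_fm a (swap_fm y z \<psi>1)))"
      using z eq by (simp add: close_enc_fm_swap)
    then have "nameless (enc_fm a (swap_fm x z \<phi>1)) = nameless (enc_fm a (swap_fm y z \<psi>1))"
      by (rule close_inject) auto
    then have "equiv_fm (swap_fm x z \<phi>1) (swap_fm y z \<psi>1)"
      by (intro less.hyps) (simp_all add: FAll)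
    then show ?thesis using z by (auto simp: FAll psi intro: equiv_fm.rename)
  qed
qed

lemma equiv_expr_iff_alpha: "equiv_expr e e' \<longleftrightarrow> enc_expr a e \<approx>\<^sub>\<alpha> enc_expr a e'"
proof -
  \<comment> \<open>Terms and formulae are told apart by their outermost constructor.\<close>
  have ne: "nameless (enc_tm a t) \<noteq> nameless (enc_fm a \<phi>)" for t \<phi>
    by (cases t; cases \<phi>) auto
  show ?thesis
    by (cases e; cases e')
      (auto simp: alpha_iff_nameless_eq nameless_enc_tm_inject[OF inj] ne ne[symmetric]
        intro: equiv_fm_imp_nameless_eq nameless_eq_imp_equiv_fm)
qed

section \<open>Substitution\<close>

lemma nameless_enc_tm_subst:
  "nameless (enc_tm a (subst_tm s y t)) =
    lsubst (a y) (nameless (enc_tm a t)) (nameless (enc_tm a s))"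
  using inj by (induction s) (auto dest: injD)

text \<open>\<open>subst_fm\<close> renames a binder only to avoid capture, whereas
  \<open>asubst\<close> renames every binder other than the substituted atom; comparing both with
  \<open>lsubst\<close> makes this difference disappear.\<close>

lemma nameless_enc_fm_subst:
  "nameless (enc_fm a (subst_fm \<phi> y t)) =
    lsubst (a y) (nameless (enc_tm a t)) (nameless (enc_fm a \<phi>))"
proof (induction \<phi> y t rule: subst_fm.induct)
  case (5 x \<phi> y t)
  \<comment> \<open>Used for the binder \<open>x\<close> when it is kept and for its fresh
    replacement \<open>z\<close> otherwise.\<close>
  have close_subst: "close 0 (a z) (lsubst (a y) (nameless (enc_tm a t)) M)
      = lsubst (a y) (nameless (enc_tm a t)) (close 0 (a z) M)"
    if "z \<noteq> y" "z \<notin> fv_tm t" for z M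
    using that inj by (intro close_lsubst) (auto dest: injD)
  consider "x = y" | "x \<noteq> y" "x \<notin> fv_tm t" | "x \<noteq> y" "x \<in> fv_tm t" by blast
  then show ?case
  proof cases
    case 1
    then show ?thesis by (simp add: lsubst_fresh)
  next
    case 2
    then show ?thesis using 5(1) by (simp add: close_subst)
  next
    case 3
    define z where "z = (SOME z. z \<notin> fv_tm t \<union> fv_fm \<phi> \<union> {x, y})"
    have "\<exists>z. z \<notin> fv_tm t \<union> fv_fm \<phi> \<union> {x, y}"
      using infinite_var by (intro ex_new_if_finite) auto
    then have z: "z \<notin> fv_tm t \<union> fv_fm \<phi> \<union> {x, y}"
      unfolding z_def by (rule someI_ex)
    have "subst_fm (FAll x \<phi>) y t = FAll z (subst_fm (swap_fm x z \<phi>) y t)"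
      using 3 by (simp add: z_def Let_def)
    then show ?thesis
      using 5(2)[OF 3(1) _ z_def] 3 z by (simp add: close_subst close_enc_fm_swap)
  qed
qed (auto simp: nameless_enc_tm_subst)

lemma enc_subst_expr:
  "enc_expr a (subst_expr e x t) \<approx>\<^sub>\<alpha> asubst (enc_expr a e) (a x) (enc_tm a t)"
  by (cases e)
    (simp_all add: alpha_iff_nameless_eq nameless_asubst nameless_enc_tm_subst nameless_enc_fm_subst)

section \<open>Sorting\<close>

lemma has_sort_enc_tm:
  "\<forall>x\<in>fv_tm t. map_of \<Gamma> (\<pi> (a x)) = Some Term \<Longrightarrow>
    has_sort \<Gamma> (perm_term \<pi> (enc_tm a t)) (SData Term [])"
  by (induction t) (auto intro!: has_sort.atom has_sort.app)

lemma has_sort_enc_fm: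
  "inj \<pi> \<Longrightarrow> \<forall>x\<in>fv_fm \<phi>. map_of \<Gamma> (\<pi> (a x)) = Some Term \<Longrightarrow>
    has_sort \<Gamma> (perm_term \<pi> (enc_fm a \<phi>)) (SData Form [])"
proof (induction \<phi> arbitrary: \<pi> \<Gamma>)
  case (FAll x \<phi>)
  let ?M = "perm_term \<pi> (enc_fm a \<phi>)"
  obtain b where b: "b \<notin> dom_ctx \<Gamma> \<union> set_ln (nameless ?M)"
    using ex_new_if_finite[OF infinite_atom, of "dom_ctx \<Gamma> \<union> set_ln (nameless ?M)"]
    by (auto simp: dom_ctx_def)
  \<comment> \<open>The swap required by the abstraction rule is absorbed into the renaming:
    \<open>\<rho>\<close> sends \<open>a x\<close> to \<open>b\<close> and agrees with
    \<open>\<pi>\<close> on the atoms of the other free variables of the body.\<close>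
  define \<rho> where "\<rho> = transpose (\<pi> (a x)) b \<circ> \<pi>"
  have "inj \<rho>" unfolding \<rho>_def using FAll.prems(1) by (auto intro: inj_compose)
  moreover have "map_of (\<Gamma> @ [(b, Term)]) (\<rho> (a y)) = Some Term" if y: "y \<in> fv_fm \<phi>" for y
  proof (cases "y = x")
    case True
    \<comment> \<open>\<open>map_of\<close> takes the first match and \<open>b\<close> is declared
      last, so \<open>b\<close> must not occur earlier.\<close>
    have "map_of \<Gamma> b = None" using b by (auto simp: dom_ctx_def map_of_eq_None_iff)
    then show ?thesis using True by (auto simp: \<rho>_def map_add_def)
  next
    case False
    have "\<pi> (a y) \<noteq> \<pi> (a x)" using False FAll.prems(1) inj by (auto dest!: injD)
    moreover have "\<pi> (a y) \<noteq> b"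
      using b y FAll.prems(1) by (auto simp: nameless_perm ln.set_map)
    ultimately have "\<rho> (a y) = \<pi> (a y)" by (simp add: \<rho>_def)
    then show ?thesis using FAll.prems(2) y False b
      by (auto simp: map_add_def dom_ctx_def split: option.split)
  qed
  ultimately have "has_sort (\<Gamma> @ [(b, Term)]) (perm_term \<rho> (enc_fm a \<phi>)) (SData Form [])"
    using FAll.IH by blast
  then have "has_sort \<Gamma> (GAbs (\<pi> (a x)) Term [] ?M) (SAbs (\<pi> (a x)) Term [] (SData Form []))"
    using b by (intro has_sort.abs[where b = b]) (auto simp: \<rho>_def perm_term_comp fresh_term_iff)
  \<comment> \<open>The signature names the atom \<open>A 0\<close> in the argument sort of
    \<open>All_c\<close>; conversion bridges the gap.\<close>
  moreover have "alpha_sort (SAbs (\<pi> (a x)) Term [] (SData Form [])) (SAbs (A 0) Term [] (SData Form []))"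
    by (cases "\<pi> (a x) = A 0") (auto intro!: alpha_sort.intros)
  ultimately show ?case by (auto intro!: has_sort.app intro: has_sort.conv)
qed (auto intro!: has_sort.app has_sort_enc_tm)

section \<open>Every well-sorted term is an encoding up to alpha\<close>

lemma inj_comp_transpose: "inj \<pi> \<Longrightarrow> \<pi> \<circ> transpose c b = transpose (\<pi> c) (\<pi> b) \<circ> \<pi>"
  by (auto simp: fun_eq_iff transpose_def dest: injD)

lemma hat_ctx_map_of: "hat_ctx a V \<Gamma> \<Longrightarrow> x \<in> V \<Longrightarrow> map_of \<Gamma> (a x) = Some Term"
  by (auto simp: hat_ctx_def intro!: map_of_is_SomeI)

text \<open>The renaming \<open>\<pi>\<close> moves the declared atoms into \<open>range a\<close>,
  where atoms encode variables; an atom \<open>b\<close> added by the abstraction rule may lie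
  outside. Since only \<open>Term\<close> is declared, an atom can never have sort
  \<open>Form\<close>.\<close>

lemma has_sort_in_image:
  "has_sort \<Gamma> u \<gamma> \<Longrightarrow> snd ` set \<Gamma> \<subseteq> {Term} \<Longrightarrow> inj \<pi> \<Longrightarrow> \<pi> ` dom_ctx \<Gamma> \<subseteq> range a \<Longrightarrow>
    in_image a \<gamma> (nameless (perm_term \<pi> u))"
proof (induction arbitrary: \<pi> rule: has_sort.induct)
  case (atom \<Gamma> b F)
  then have "(b, F) \<in> set \<Gamma>" by (simp add: map_of_SomeD)
  then have "F = Term" "\<pi> b \<in> range a" using atom.prems by (force simp: dom_ctx_def)+
  then show ?case by (auto intro: exI[of _ "TVar x" for x])
next
  case (app f \<gamma>s F \<Gamma> ts)
  have "list_all2 (\<lambda>t \<gamma>. in_image a \<gamma> (nameless (perm_term \<pi> t))) ts \<gamma>s"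
    using app.IH app.prems by (auto elim!: list_all2_mono)
  with app.hyps show ?case
    by (cases f) (auto simp: list_all2_Cons2 close_fresh ex_enc_eq)
next
  case (abs \<Gamma> b F c t \<gamma>)
  have "\<exists>x \<phi>. nameless (perm_term \<pi> (GAbs c F [] t)) = nameless (GAbs (a x) Term [] (enc_fm a \<phi>))"
    if F: "F = Term" and \<gamma>: "\<gamma> = SData Form ss" for ss
  proof -
    let ?N = "perm_term \<pi> t"
    let ?M = "perm_term (transpose (\<pi> c) (\<pi> b)) ?N"
    \<comment> \<open>By injectivity infinitely many atoms encode variables, so one of them avoids
      the renamed context and the free atoms of the body.\<close>
    have "infinite (range a)"
      using infinite_var inj by (simp add: finite_image_iff)
    moreover have "finite (\<pi> ` dom_ctx \<Gamma> \<union> set_ln (nameless ?M))"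
      by (simp add: dom_ctx_def)
    ultimately have "\<exists>d\<in>range a. d \<notin> \<pi> ` dom_ctx \<Gamma> \<union> set_ln (nameless ?M)"
      by (meson finite_subset subsetI)
    then obtain x where x: "a x \<notin> \<pi> ` dom_ctx \<Gamma>" "fresh_term (a x) ?M"
      by (auto simp: fresh_term_iff)
    \<comment> \<open>\<open>\<rho>\<close> sends \<open>b\<close> to \<open>a x\<close> and agrees
      with \<open>\<pi>\<close> on the old context, so the induction hypothesis applies to the
      extended one.\<close>
    define \<rho> where "\<rho> = transpose (\<pi> b) (a x) \<circ> \<pi>"
    have "inj \<rho>" unfolding \<rho>_def using abs.prems(2) by (auto intro: inj_compose)
    moreover have "\<rho> d = \<pi> d" if "d \<in> dom_ctx \<Gamma>" for d
    proof -
      have "\<pi> d \<noteq> \<pi> b" using that abs.prems(2) abs.hyps(2) by (auto dest: injD)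
      moreover have "\<pi> d \<noteq> a x" using that x(1) by force
      ultimately show ?thesis by (simp add: \<rho>_def)
    qed
    then have "\<rho> ` dom_ctx (\<Gamma> @ [(b, F)]) \<subseteq> range a"
      using abs.prems(3) by (auto simp: \<rho>_def dom_ctx_def image_subset_iff)
    ultimately obtain \<phi>
      where \<phi>: "nameless (enc_fm a \<phi>) = nameless (perm_term \<rho> (perm_term (transpose c b) t))"
      using abs.IH[of \<rho>] abs.prems(1) F \<gamma> by auto
    have "perm_term \<rho> (perm_term (transpose c b) t) = perm_term (transpose (\<pi> b) (a x)) ?M"
      using inj_comp_transpose[OF abs.prems(2)]
      by (simp add: \<rho>_def perm_term_comp comp_assoc)
    \<comment> \<open>The bound name is exchanged twice: \<open>a x\<close> for
      \<open>\<pi> b\<close>, and then \<open>\<pi> b\<close> for \<open>\<pi> c\<close>, the name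
      in the given term.\<close>
    then have "close 0 (a x) (nameless (enc_fm a \<phi>)) = close 0 (\<pi> b) (nameless ?M)"
      using x(2) by (simp add: \<phi> close_nameless_transpose)
    also have "\<dots> = close 0 (\<pi> c) (nameless ?N)"
      using abs.hyps(3) abs.prems(2)
      by (intro close_nameless_transpose)
        (auto simp: fresh_term_iff nameless_perm ln.set_map dest: injD)
    finally show ?thesis using F by (intro exI[of _ x] exI[of _ \<phi>]) simp
  qed
  then show ?case by auto
next
  case (conv \<Gamma> t \<gamma> \<gamma>')
  then show ?case using in_image_alpha by metis
qed

lemma hat_ctx_in_image:
  assumes "hat_ctx a V \<Gamma>" "has_sort \<Gamma> u \<gamma>"
  shows "in_image a \<gamma> (nameless u)"
proof -
  have "snd ` set \<Gamma> \<subseteq> {Term}" "id ` dom_ctx \<Gamma> \<subseteq> range a"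
    using assms(1) by (auto simp: hat_ctx_def dom_ctx_def)
  from has_sort_in_image[OF assms(2) this(1) _ this(2)] show ?thesis by simp
qed

end

theorem lemma8:
  fixes a :: "var \<Rightarrow> atom"
  assumes "inj a"
  shows "\<exists>enc :: expr \<Rightarrow> gterm.
     (\<forall>x. enc (ETm (TVar x)) = GAtom (a x))
   \<and> (\<forall>t \<Gamma>. hat_ctx a (fv_tm t) \<Gamma> \<longrightarrow> has_sort \<Gamma> (enc (ETm t)) (SData Term []))
   \<and> (\<forall>\<phi> \<Gamma>. hat_ctx a (fv_fm \<phi>) \<Gamma> \<longrightarrow> has_sort \<Gamma> (enc (EFm \<phi>)) (SData Form []))
   \<and> (\<forall>e e'. equiv_expr e e' \<longleftrightarrow> enc e \<approx>\<^sub>\<alpha> enc e')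
   \<and> (\<forall>V \<Gamma> u. finite V \<longrightarrow> hat_ctx a V \<Gamma> \<longrightarrow> has_sort \<Gamma> u (SData Term [])
        \<longrightarrow> (\<exists>t. enc (ETm t) \<approx>\<^sub>\<alpha> u))
   \<and> (\<forall>V \<Gamma> u. finite V \<longrightarrow> hat_ctx a V \<Gamma> \<longrightarrow> has_sort \<Gamma> u (SData Form [])
        \<longrightarrow> (\<exists>\<phi>. enc (EFm \<phi>) \<approx>\<^sub>\<alpha> u))
   \<and> (\<forall>e x t. enc (subst_expr e x t) \<approx>\<^sub>\<alpha> asubst (enc e) (a x) (enc (ETm t)))"
proof (intro exI[of _ "enc_expr a"] conjI allI impI)
  show "has_sort \<Gamma> (enc_expr a (ETm t)) (SData Term [])" if "hat_ctx a (fv_tm t) \<Gamma>" for t \<Gamma>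
    \<comment> \<open>The identity renaming recovers sorting of the encoding itself.\<close>
    using has_sort_enc_tm[OF assms, of t \<Gamma> id] hat_ctx_map_of[OF assms that]
    by simp
  show "has_sort \<Gamma> (enc_expr a (EFm \<phi>)) (SData Form [])" if "hat_ctx a (fv_fm \<phi>) \<Gamma>" for \<phi> \<Gamma>
    using has_sort_enc_fm[OF assms, of id \<phi> \<Gamma>] hat_ctx_map_of[OF assms that]
    by simp
  show "equiv_expr e e' \<longleftrightarrow> enc_expr a e \<approx>\<^sub>\<alpha> enc_expr a e'" for e e'
    using assms by (rule equiv_expr_iff_alpha)
  show "\<exists>t. enc_expr a (ETm t) \<approx>\<^sub>\<alpha> u"
    if "hat_ctx a V \<Gamma>" "has_sort \<Gamma> u (SData Term [])" for V \<Gamma> u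
    using hat_ctx_in_image[OF assms that]
    by (auto simp: alpha_iff_nameless_eq)
  show "\<exists>\<phi>. enc_expr a (EFm \<phi>) \<approx>\<^sub>\<alpha> u"
    if "hat_ctx a V \<Gamma>" "has_sort \<Gamma> u (SData Form [])" for V \<Gamma> u
    using hat_ctx_in_image[OF assms that]
    by (auto simp: alpha_iff_nameless_eq)
  show "enc_expr a (subst_expr e x t) \<approx>\<^sub>\<alpha> asubst (enc_expr a e) (a x) (enc_expr a (ETm t))" for e x t
    using enc_subst_expr[OF assms] by simp
qed simp

end
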